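(* Let $\mathcal P$ be the set of all primes. For every non-empty subset $Q \subseteq \mathcal P$ the prime power-invertibility spectrum of the coarse group $(\mathbb Z, \mathcal E_Q)$ is $$\mathfrak S_{\mathcal P}(\mathbb Z, \mathcal E_Q) = Q.$$
   Context: For a non-empty set $Q$ of primes, let $Q^*$ be the set of positive integers $m$ with $\gcd(m,p)=1$ for every prime $p \notin Q$ (i.e. products of powers of primes in $Q$). Let $\mathbb Z_Q = \varprojlim_{m \in Q^*} \mathbb Z/m\mathbb Z$ with the limit topology (each finite quotient being discrete). The natural map $\mathbb Z \to \mathbb Z_Q$ is injective; let $\tau_Q$ be the topology induced on $\mathbb Z$ (the sets $k+m\mathbb Z$, $k \in \mathbb Z$, $m \in Q^*$, form a basis). The profinite coarse structure $\mathcal E_Q$ on $\mathbb Z$ is defined by declaring a family $(A_i)_{i\in I}$ of subsets of $\mathbb Z$ to be uniformly $\mathcal E_Q$-bounded if and only if there is a $\tau_Q$-compact subset $K \subset \mathbb Z$ such that for every $i\in I$ there is $k_i \in \mathbb Z$ with $A_i \subseteq k_i + K$. $(\mathbb Z,\mathcal E_Q)$ is regarded as a coarse group under addition. A function $f\colon (\mathbb Z,\mathcal E_Q) \to (\mathbb Z, \mathcal E_Q)$ is controlled if for every uniformly $\mathcal E_Q$-bounded family $(A_i)_{i \in I}$ the family $(f(A_i))_{i\in I}$ is uniformly $\mathcal E_Q$-bounded. Two functions $f, f'\colon \mathbb Z \to \mathbb Z$ are close if the family $(\{f(x),f'(x)\})_{x\in \mathbb Z}$ is uniformly $\mathcal E_Q$-bounded.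 A controlled function $f$ is a coarse equivalence if there is a controlled function $h\colon (\mathbb Z,\mathcal E_Q)\to (\mathbb Z,\mathcal E_Q)$ such that $h\circ f$ and $f\circ h$ are both close to the identity. The prime power-invertibility spectrum of a coarse group is the set of primes $p$ such that the $p$-th power map is a coarse equivalence. For $(\mathbb Z,\mathcal E_Q)$ this is $$\mathfrak S_{\mathcal P}(\mathbb Z, \mathcal E_Q) = \{p \in \mathcal P : \mu_p\colon (\mathbb Z,\mathcal E_Q)\to(\mathbb Z,\mathcal E_Q),\ k \mapsto pk, \text{ is a coarse equivalence}\}.$$ *)

theory Defs
  imports "HOL-Analysis.Analysis" "HOL-Computational_Algebra.Primes"
begin

definition Q_numbers :: "nat set \<Rightarrow> nat set" where
  "Q_numbers Q = {m. m > 0 \<and> (\<forall>p. prime p \<and> p \<notin> Q \<longrightarrow> coprime m p)}"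

text \<open>
  The quotient \<open>\<int>/m\<int>\<close> is represented by the residues \<open>{0..<m}\<close>; its transition map to
  \<open>\<int>/d\<int>\<close>, for \<open>d\<close> dividing \<open>m\<close>, is then reduction modulo \<open>d\<close>.
\<close>

definition Z_profinite :: "nat set \<Rightarrow> (nat \<Rightarrow> int) topology" where
  "Z_profinite Q =
     subtopology (product_topology (\<lambda>m. discrete_topology {0..<int m}) (Q_numbers Q))
       {x. \<forall>d\<in>Q_numbers Q. \<forall>m\<in>Q_numbers Q. d dvd m \<longrightarrow> x m mod int d = x d}"

definition Z_embed :: "nat set \<Rightarrow> int \<Rightarrow> nat \<Rightarrow> int" where
  "Z_embed Q k = (\<lambda>m\<in>Q_numbers Q. k mod int m)"

definition tau :: "nat set \<Rightarrow> int topology" where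
  "tau Q = pullback_topology UNIV (Z_embed Q) (Z_profinite Q)"

definition uniformly_bounded :: "nat set \<Rightarrow> 'i set \<Rightarrow> ('i \<Rightarrow> int set) \<Rightarrow> bool" where
  "uniformly_bounded Q I A \<longleftrightarrow>
     (\<exists>K. compactin (tau Q) K \<and> (\<forall>i\<in>I. \<exists>k. A i \<subseteq> (\<lambda>x. k + x) ` K))"

text \<open>
  A definition cannot quantify over index types. The index type \<^typ>\<open>int set\<close> suffices, since
  every family of subsets of \<open>\<int>\<close> can be indexed by its own range; the lemma
  \<open>controlledD\<close> below recovers the condition for families over an arbitrary index type.
\<close>

definition controlled :: "nat set \<Rightarrow> (int \<Rightarrow> int) \<Rightarrow> bool" where
  "controlled Q f \<longleftrightarrow>
     (\<forall>(I :: int set set) A. uniformly_bounded Q I A \<longrightarrow> uniformly_bounded Q I (\<lambda>i. f ` A i))"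

definition close :: "nat set \<Rightarrow> (int \<Rightarrow> int) \<Rightarrow> (int \<Rightarrow> int) \<Rightarrow> bool" where
  "close Q f f' \<longleftrightarrow> uniformly_bounded Q UNIV (\<lambda>x. {f x, f' x})"

definition coarse_equivalence :: "nat set \<Rightarrow> (int \<Rightarrow> int) \<Rightarrow> bool" where
  "coarse_equivalence Q f \<longleftrightarrow>
     controlled Q f \<and> (\<exists>h. controlled Q h \<and> close Q (h \<circ> f) id \<and> close Q (f \<circ> h) id)"

definition prime_power_invertibility_spectrum :: "nat set \<Rightarrow> nat set" where
  "prime_power_invertibility_spectrum Q =
     {p. prime p \<and> coarse_equivalence Q (\<lambda>k. int p * k)}"

lemma controlledD:
  fixes I :: "'i set"
  assumes "controlled Q f" "uniformly_bounded Q I A"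
  shows "uniformly_bounded Q I (\<lambda>i. f ` A i)"
proof -
  have "uniformly_bounded Q (A ` I) (\<lambda>B. B)"
    using assms(2) by (auto simp: uniformly_bounded_def)
  then have "uniformly_bounded Q (A ` I) (\<lambda>B. f ` B)"
    using assms(1) by (auto simp: controlled_def)
  then show ?thesis
    by (auto simp: uniformly_bounded_def)
qed

lemma Q_numbers_prod:
  assumes "finite F" "F \<subseteq> Q_numbers Q"
  shows "\<Prod>F \<in> Q_numbers Q"
  using assms
proof (induction F rule: finite_induct)
  case empty
  then show ?case by (simp add: Q_numbers_def)
next
  case (insert a F)
  then show ?case
    by (auto simp: Q_numbers_def)
qed

lemma Z_embed_in_Z_profinite: "Z_embed Q k \<in> topspace (Z_profinite Q)"
  by (auto simp: Z_profinite_def Z_embed_def Q_numbers_def mod_mod_cancel)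

lemma inj_Z_embed:
  assumes "Q \<noteq> {}" "\<forall>p\<in>Q. prime p"
  shows "inj (Z_embed Q)"
proof (rule injI)
  fix a b assume eq: "Z_embed Q a = Z_embed Q b"
  obtain p where p: "p \<in> Q" "prime p" using assms by auto
  define m where "m = p ^ nat (\<bar>a - b\<bar> + 1)"
  have m: "m \<in> Q_numbers Q"
    using p assms(2)
    by (auto simp: m_def Q_numbers_def prime_gt_0_nat intro!: primes_coprime)
  from fun_cong[OF eq, of m] have "a mod int m = b mod int m"
    using m by (simp add: Z_embed_def)
  then have dvd: "int m dvd a - b" by (simp add: mod_eq_dvd_iff)
  have "nat (\<bar>a - b\<bar> + 1) < m"
    unfolding m_def using prime_gt_1_nat[OF p(2)] by (intro power_gt_expt) simp
  then have "\<bar>a - b\<bar> < int m" by linarith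
  with dvd show "a = b"
    by (metis abs_dvd_iff dvd_abs_iff zdvd_not_zless abs_ge_zero order_le_less abs_eq_0 eq_iff_diff_eq_0)
qed

text \<open>The residue classes \<open>k + m\<int>\<close> with \<open>m\<close> in \<^term>\<open>Q_numbers Q\<close> form a basis of \<^term>\<open>tau Q\<close>.\<close>

lemma openin_tau_iff:
  "openin (tau Q) U \<longleftrightarrow> (\<forall>k\<in>U. \<exists>m\<in>Q_numbers Q. range (\<lambda>j. k + int m * j) \<subseteq> U)"
proof
  assume "openin (tau Q) U"
  then obtain W where W: "openin (product_topology (\<lambda>m. discrete_topology {0..<int m}) (Q_numbers Q)) W"
    and U: "U = Z_embed Q -` (W \<inter> topspace (Z_profinite Q))"
  proof -
    assume *: "\<And>W. openin (product_topology (\<lambda>m. discrete_topology {0..<int m}) (Q_numbers Q)) W \<Longrightarrow>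
      U = Z_embed Q -` (W \<inter> topspace (Z_profinite Q)) \<Longrightarrow> thesis"
    obtain T where T: "openin (Z_profinite Q) T" "U = Z_embed Q -` T"
      using \<open>openin (tau Q) U\<close> by (auto simp: tau_def openin_pullback_topology)
    then obtain W where W: "openin (product_topology (\<lambda>m. discrete_topology {0..<int m}) (Q_numbers Q)) W"
      and TW: "T = W \<inter> {x. \<forall>d\<in>Q_numbers Q. \<forall>m\<in>Q_numbers Q. d dvd m \<longrightarrow> x m mod int d = x d}"
      by (auto simp: Z_profinite_def openin_subtopology)
    have "T = W \<inter> topspace (Z_profinite Q)"
      using TW openin_subset[OF W]
      unfolding Z_profinite_def topspace_subtopology by blast
    then show thesis using * T W by blast
  qed
  show "\<forall>k\<in>U. \<exists>m\<in>Q_numbers Q. range (\<lambda>j. k + int m * j) \<subseteq> U"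
  proof
    fix k assume "k \<in> U"
    then have "Z_embed Q k \<in> W" by (simp add: U)
    then obtain V where fin: "finite {m \<in> Q_numbers Q. V m \<noteq> {0..<int m}}"
      and V: "Z_embed Q k \<in> PiE (Q_numbers Q) V" "PiE (Q_numbers Q) V \<subseteq> W"
      using W by (auto simp: openin_product_topology_alt)
    define F where "F = {m \<in> Q_numbers Q. V m \<noteq> {0..<int m}}"
    have F: "\<Prod>F \<in> Q_numbers Q" using fin by (intro Q_numbers_prod) (auto simp: F_def)
    have "k + int (\<Prod>F) * j \<in> U" for j
    proof -
      have "(k + int (\<Prod>F) * j) mod int m \<in> V m" if m: "m \<in> Q_numbers Q" for m
      proof (cases "m \<in> F")
        case True
        then have "m dvd \<Prod>F"
          using fin dvd_prodI[of F m "\<lambda>x. x"] by (simp add: F_def)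
        then have "int m dvd int (\<Prod>F) * j"
          by (intro dvd_mult2) (simp only: int_dvd_int_iff)
        then have "(k + int (\<Prod>F) * j) mod int m = k mod int m"
          by (metis add.right_neutral dvd_imp_mod_0 mod_add_right_eq)
        moreover have "k mod int m \<in> V m"
          using V(1) m by (auto simp: Z_embed_def)
        ultimately show ?thesis by simp
      next
        case False
        then show ?thesis using m by (auto simp: F_def Q_numbers_def)
      qed
      then have "Z_embed Q (k + int (\<Prod>F) * j) \<in> W"
        using V(2) by (auto simp: Z_embed_def)
      then show ?thesis using Z_embed_in_Z_profinite by (auto simp: U)
    qed
    then show "\<exists>m\<in>Q_numbers Q. range (\<lambda>j. k + int m * j) \<subseteq> U" using F by blast
  qed
next
  assume R: "\<forall>k\<in>U. \<exists>m\<in>Q_numbers Q. range (\<lambda>j. k + int m * j) \<subseteq> U"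
  show "openin (tau Q) U"
  proof (subst openin_subopen, intro ballI)
    fix k assume "k \<in> U"
    then obtain m where m: "m \<in> Q_numbers Q" "range (\<lambda>j. k + int m * j) \<subseteq> U" using R by blast
    define W where "W = {x \<in> topspace (Z_profinite Q). x m \<in> {k mod int m}}"
    have "continuous_map (Z_profinite Q) (discrete_topology {0..<int m}) (\<lambda>x. x m)"
      unfolding Z_profinite_def using m(1)
      by (intro continuous_map_from_subtopology continuous_map_product_projection)
    then have "openin (Z_profinite Q) W"
      unfolding W_def by (rule openin_continuous_map_preimage)
        (use m(1) in \<open>auto simp: Q_numbers_def\<close>)
    then have "openin (tau Q) (Z_embed Q -` W)"
      unfolding tau_def openin_pullback_topology by auto
    moreover have "k \<in> Z_embed Q -` W"
      using Z_embed_in_Z_profinite m(1) by (auto simp: W_def Z_embed_def)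
    moreover have "Z_embed Q -` W \<subseteq> U"
    proof
      fix l assume "l \<in> Z_embed Q -` W"
      then have "l mod int m = k mod int m" using m(1) by (auto simp: W_def Z_embed_def)
      then have "int m dvd l - k" by (simp add: mod_eq_dvd_iff)
      then obtain j where "l - k = int m * j" by (elim dvdE)
      then have "l = k + int m * j" by simp
      then show "l \<in> U" using m(2) by blast
    qed
    ultimately show "\<exists>T. openin (tau Q) T \<and> k \<in> T \<and> T \<subseteq> U" by blast
  qed
qed

end

theory Submission
  imports Defs
begin

text \<open>
  For \<open>p \<in> Q\<close>, division with remainder by \<open>p\<close> is a \<open>\<tau>\<^sub>Q\<close>-continuous coarse inverse of
  multiplication by \<open>p\<close>.

  For \<open>p \<notin> Q\<close>, let \<open>h\<close> be a coarse inverse, so that \<open>p * h x - x\<close> lies in a fixed compact set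
  \<open>L\<close>, and let \<open>G\<close> be the closure of the graph of \<open>h\<close>. Since \<open>h\<close> is controlled,
  the second components of points of \<open>G\<close> over a convergent sequence subconverge in \<open>\<int>\<close>.
  Among the closed \<open>E \<subseteq> L\<close> such that every \<open>y\<close> has some
  \<open>(y, m) \<in> G\<close> with \<open>p * m - y \<in> E\<close> there is a minimal one. It has no isolated point \<open>e\<close>:
  choose integers \<open>w\<^sub>n \<rightarrow> 0\<close> not divisible by \<open>p\<close> and \<open>(y + w\<^sub>n, m\<^sub>n) \<in> G\<close> with
  \<open>p * m\<^sub>n - (y + w\<^sub>n) \<in> E\<close>; for a limit \<open>m\<close> of a subsequence of the \<open>m\<^sub>n\<close>, the point
  \<open>p * m - y\<close> is not in the same class mod \<open>p\<close> as its approximants, hence differs from them, and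
  so \<open>E - {e}\<close> would do as well. But a nonempty countable compact set has an isolated point.
\<close>

section \<open>Convergence in \<open>\<tau>\<^sub>Q\<close>\<close>

text \<open>A divisibility chain in \<open>Q_numbers Q\<close> that is cofinal: every element
  divides some member. It thus provides countably many congruences that determine
  \<open>\<tau>\<^sub>Q\<close>.\<close>

definition Q_modulus :: "nat set \<Rightarrow> nat \<Rightarrow> nat" where
  "Q_modulus Q n = \<Prod>{m \<in> Q_numbers Q. m \<le> n}"

lemma Q_modulus_in: "Q_modulus Q n \<in> Q_numbers Q"
  unfolding Q_modulus_def by (rule Q_numbers_prod) auto

lemma dvd_Q_modulus: "m \<in> Q_numbers Q \<Longrightarrow> m dvd Q_modulus Q m"
  unfolding Q_modulus_def using dvd_prodI[of "{k \<in> Q_numbers Q. k \<le> m}" m "\<lambda>x. x"] by simp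

lemma Q_modulus_mono: "k \<le> n \<Longrightarrow> int (Q_modulus Q k) dvd int (Q_modulus Q n)"
  unfolding Q_modulus_def int_dvd_int_iff
  by (rule prod_dvd_prod_subset) auto

lemma Q_modulus_separates:
  assumes "Q \<noteq> {}" "\<forall>p\<in>Q. prime p" and "\<And>n. int (Q_modulus Q n) dvd a"
  shows "a = 0"
proof -
  have "int m dvd a" if "m \<in> Q_numbers Q" for m
    using dvd_Q_modulus[OF that] assms(3)[of m] dvd_trans int_dvd_int_iff by blast
  then have "Z_embed Q a = Z_embed Q 0"
    by (auto simp: Z_embed_def restrict_def)
  then show ?thesis
    using inj_Z_embed[OF assms(1,2)] by (simp add: inj_eq)
qed

definition Q_ball :: "nat set \<Rightarrow> int \<Rightarrow> nat \<Rightarrow> int set" where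
  "Q_ball Q a k = {x. int (Q_modulus Q k) dvd x - a}"

lemma openin_Q_ball: "openin (tau Q) (Q_ball Q a k)"
  unfolding openin_tau_iff
proof
  fix x assume x: "x \<in> Q_ball Q a k"
  have "int (Q_modulus Q k) dvd x + int (Q_modulus Q k) * j - a" for j
    using dvd_add[of "int (Q_modulus Q k)" "x - a" "int (Q_modulus Q k) * j"] x
    by (simp add: Q_ball_def algebra_simps)
  then have "range (\<lambda>j. x + int (Q_modulus Q k) * j) \<subseteq> Q_ball Q a k"
    by (auto simp: Q_ball_def)
  then show "\<exists>m\<in>Q_numbers Q. range (\<lambda>j. x + int m * j) \<subseteq> Q_ball Q a k"
    using Q_modulus_in by blast
qed

lemma openin_tau_Q_ball:
  assumes "openin (tau Q) U" "a \<in> U"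
  obtains k where "Q_ball Q a k \<subseteq> U"
proof -
  obtain m where m: "m \<in> Q_numbers Q" "range (\<lambda>j. a + int m * j) \<subseteq> U"
    using assms openin_tau_iff by blast
  have "Q_ball Q a m \<subseteq> U"
  proof
    fix x assume "x \<in> Q_ball Q a m"
    then have "int m dvd x - a"
      using dvd_Q_modulus[OF m(1)] by (auto simp: Q_ball_def intro: dvd_trans)
    then obtain j where "x - a = int m * j" by (elim dvdE)
    then have "x = a + int m * j" by simp
    with m(2) show "x \<in> U" by blast
  qed
  then show thesis using that by blast
qed

lemma topspace_tau [simp]: "topspace (tau Q) = UNIV"
proof -
  have "openin (tau Q) UNIV"
    using Q_modulus_in by (auto simp: openin_tau_iff)
  then show ?thesis
    using openin_subset by blast
qed

text \<open>Convergence at a prescribed rate; by compactness nothing is lost by this.\<close>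

definition Q_lim :: "nat set \<Rightarrow> (nat \<Rightarrow> int) \<Rightarrow> int \<Rightarrow> bool" where
  "Q_lim Q f a \<longleftrightarrow> (\<forall>n. int (Q_modulus Q n) dvd f n - a)"

text \<open>The rate survives because \<open>n \<le> r n\<close> and the moduli form a divisibility
  chain.\<close>

lemma Q_lim_subseq: "Q_lim Q f a \<Longrightarrow> strict_mono r \<Longrightarrow> Q_lim Q (f \<circ> r) a"
  unfolding Q_lim_def comp_def
  by (meson Q_modulus_mono dvd_trans seq_suble)

lemma Q_lim_diff: "Q_lim Q f a \<Longrightarrow> Q_lim Q g b \<Longrightarrow> Q_lim Q (\<lambda>n. f n - g n) (a - b)"
  unfolding Q_lim_def
proof
  fix n
  assume "\<forall>n. int (Q_modulus Q n) dvd f n - a" "\<forall>n. int (Q_modulus Q n) dvd g n - b"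
  then have "int (Q_modulus Q n) dvd (f n - a) - (g n - b)"
    using dvd_diff by blast
  then show "int (Q_modulus Q n) dvd f n - g n - (a - b)"
    by (simp add: algebra_simps)
qed

lemma Q_lim_const: "Q_lim Q (\<lambda>_. a) a"
  by (simp add: Q_lim_def)

lemma Q_lim_add: "Q_lim Q f a \<Longrightarrow> Q_lim Q g b \<Longrightarrow> Q_lim Q (\<lambda>n. f n + g n) (a + b)"
  using Q_lim_diff[OF _ Q_lim_diff[OF Q_lim_const[of Q 0]], of f a g b] by simp

lemma Q_lim_mult: "Q_lim Q f a \<Longrightarrow> Q_lim Q (\<lambda>n. c * f n) (c * a)"
  unfolding Q_lim_def by (metis dvd_mult right_diff_distrib)

lemma Q_lim_unique:
  assumes "Q \<noteq> {}" "\<forall>p\<in>Q. prime p" "Q_lim Q f a" "Q_lim Q f b"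
  shows "a = b"
proof -
  have "a - b = 0"
    using Q_lim_diff[OF assms(4,3)]
    by (intro Q_modulus_separates[OF assms(1,2)]) (simp add: Q_lim_def)
  then show ?thesis by simp
qed

text \<open>Sequential form of closedness in \<open>\<tau>\<^sub>Q\<close>: a point in the closure
  of \<open>A\<close> is a limit at the prescribed rate, since the \<open>n\<close>-th term can be
  picked in the \<open>n\<close>-th ball.\<close>

definition Q_closed :: "nat set \<Rightarrow> int set \<Rightarrow> bool" where
  "Q_closed Q A \<longleftrightarrow> (\<forall>f a. (\<forall>n. f n \<in> A) \<and> Q_lim Q f a \<longrightarrow> a \<in> A)"

lemma Q_closedD: "Q_closed Q A \<Longrightarrow> (\<And>n. f n \<in> A) \<Longrightarrow> Q_lim Q f a \<Longrightarrow> a \<in> A"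
  by (auto simp: Q_closed_def)

lemma Q_closed_Inter: "(\<And>n. Q_closed Q (A n)) \<Longrightarrow> Q_closed Q (\<Inter>n. A n)"
  unfolding Q_closed_def by blast

lemma Q_closed_diff_ball:
  assumes "Q_closed Q A"
  shows "Q_closed Q (A - Q_ball Q c k)"
  unfolding Q_closed_def
proof (intro allI impI, elim conjE)
  fix f a assume f: "\<forall>n. f n \<in> A - Q_ball Q c k" "Q_lim Q f a"
  have "\<not> int (Q_modulus Q k) dvd a - c"
  proof
    assume "int (Q_modulus Q k) dvd a - c"
    then have "int (Q_modulus Q k) dvd (f k - a) + (a - c)"
      using f(2) by (intro dvd_add) (auto simp: Q_lim_def)
    then show False using f(1) by (auto simp: Q_ball_def)
  qed
  moreover have "a \<in> A" using Q_closedD[OF assms _ f(2)] f(1) by blast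
  ultimately show "a \<in> A - Q_ball Q c k" by (simp add: Q_ball_def)
qed

section \<open>Sequential compactness\<close>

definition Q_seq_compact :: "nat set \<Rightarrow> int set \<Rightarrow> bool" where
  "Q_seq_compact Q A \<longleftrightarrow>
     (\<forall>f :: nat \<Rightarrow> int. (\<forall>n. f n \<in> A) \<longrightarrow> (\<exists>a\<in>A. \<exists>r. strict_mono r \<and> Q_lim Q (f \<circ> r) a))"

lemma Q_seq_compactE:
  assumes "Q_seq_compact Q A" "\<And>n. f n \<in> A"
  obtains a r where "a \<in> A" "strict_mono (r :: nat \<Rightarrow> nat)" "Q_lim Q (f \<circ> r) a"
  using assms unfolding Q_seq_compact_def by blast

text \<open>Some point of \<open>M\<close> has infinitely many terms in each of its balls; otherwise
  finitely many balls, each catching finitely many indices, would cover \<open>M\<close>. Taking the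
  \<open>n\<close>-th chosen term from the \<open>n\<close>-th ball gives the required rate.\<close>

lemma compactin_imp_Q_seq_compact:
  assumes "compactin (tau Q) M"
  shows "Q_seq_compact Q M"
  unfolding Q_seq_compact_def
proof (intro allI impI)
  fix f :: "nat \<Rightarrow> int" assume f: "\<forall>n. f n \<in> M"
  have "\<exists>a\<in>M. \<forall>k. infinite {n. f n \<in> Q_ball Q a k}"
  proof (rule ccontr)
    assume "\<not> ?thesis"
    then obtain k where k: "\<And>a. a \<in> M \<Longrightarrow> finite {n. f n \<in> Q_ball Q a (k a)}"
      by metis
    have "M \<subseteq> \<Union>((\<lambda>a. Q_ball Q a (k a)) ` M)"
      by (auto simp: Q_ball_def)
    moreover have "\<And>U. U \<in> (\<lambda>a. Q_ball Q a (k a)) ` M \<Longrightarrow> openin (tau Q) U"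
      using openin_Q_ball by auto
    ultimately obtain \<F>
      where F: "finite \<F>" "\<F> \<subseteq> (\<lambda>a. Q_ball Q a (k a)) ` M" "M \<subseteq> \<Union>\<F>"
      by (meson compactinD[OF assms])
    have "(UNIV :: nat set) \<subseteq> (\<Union>B\<in>\<F>. {n. f n \<in> B})"
      using f F(3) by auto
    moreover have "finite (\<Union>B\<in>\<F>. {n. f n \<in> B})"
      using F(1,2) k by auto
    ultimately show False
      using finite_subset infinite_UNIV_nat by blast
  qed
  then obtain a where a: "a \<in> M" "\<And>k. infinite {n. f n \<in> Q_ball Q a k}" by blast
  have "\<exists>r. \<forall>n. f (r n) \<in> Q_ball Q a n \<and> r n < r (Suc n)"
  proof (rule dependent_nat_choice)
    show "\<exists>x. f x \<in> Q_ball Q a 0"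
      using a(2)[of 0] not_finite_existsD by auto
    show "\<exists>y. f y \<in> Q_ball Q a (Suc n) \<and> x < y" for x n
      using a(2)[of "Suc n"] by (auto simp: infinite_nat_iff_unbounded)
  qed
  then obtain r where r: "\<And>n. f (r n) \<in> Q_ball Q a n" "\<And>n. r n < r (Suc n)" by blast
  then have "strict_mono r" "Q_lim Q (f \<circ> r) a"
    by (auto simp: strict_mono_Suc_iff Q_lim_def Q_ball_def)
  with a(1) show "\<exists>a\<in>M. \<exists>r. strict_mono r \<and> Q_lim Q (f \<circ> r) a" by blast
qed

lemma Q_seq_compact_imp_closed:
  assumes "Q \<noteq> {}" "\<forall>p\<in>Q. prime p" "Q_seq_compact Q A"
  shows "Q_closed Q A"
  unfolding Q_closed_def
proof (intro allI impI, elim conjE)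
  fix f a assume f: "\<forall>n. f n \<in> A" "Q_lim Q f a"
  then obtain b r where "b \<in> A" "strict_mono r" "Q_lim Q (f \<circ> r) b"
    using Q_seq_compactE[OF assms(3)] by blast
  then show "a \<in> A"
    using Q_lim_unique[OF assms(1,2)] Q_lim_subseq[OF f(2)] by blast
qed

lemma Q_seq_compact_differences:
  assumes "Q_seq_compact Q A" "Q_seq_compact Q B"
  shows "Q_seq_compact Q {a - b |a b. a \<in> A \<and> b \<in> B}"
  unfolding Q_seq_compact_def
proof (intro allI impI)
  fix f :: "nat \<Rightarrow> int" assume "\<forall>n. f n \<in> {a - b |a b. a \<in> A \<and> b \<in> B}"
  then have "\<forall>n. \<exists>a b. f n = a - b \<and> a \<in> A \<and> b \<in> B" by blast
  then obtain u v where uv: "\<And>n. f n = u n - v n" "\<And>n. u n \<in> A" "\<And>n. v n \<in> B"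
    by metis
  obtain a r where a: "a \<in> A" "strict_mono r" "Q_lim Q (u \<circ> r) a"
    using Q_seq_compactE[OF assms(1)] uv(2) by blast
  obtain b s where b: "b \<in> B" "strict_mono s" "Q_lim Q ((v \<circ> r) \<circ> s) b"
    using Q_seq_compactE[OF assms(2), of "v \<circ> r"] uv(3) by auto
  have "Q_lim Q (f \<circ> (r \<circ> s)) (a - b)"
    using Q_lim_diff[OF Q_lim_subseq[OF a(3) b(2)] b(3)] by (simp add: comp_def uv(1))
  moreover have "strict_mono (r \<circ> s)" using a(2) b(2) by (rule strict_mono_o)
  ultimately show "\<exists>c\<in>{a - b |a b. a \<in> A \<and> b \<in> B}. \<exists>r. strict_mono r \<and> Q_lim Q (f \<circ> r) c"
    using a(1) b(1) by blast
qed

lemma Q_lim_compactin: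
  assumes "Q_lim Q f a"
  shows "compactin (tau Q) (insert a (range f))"
  unfolding compactin_def
proof (intro conjI allI impI, simp, elim conjE)
  fix \<U> assume U: "Ball \<U> (openin (tau Q))" "insert a (range f) \<subseteq> \<Union>\<U>"
  then obtain V where V: "V \<in> \<U>" "a \<in> V" by blast
  then obtain k where k: "Q_ball Q a k \<subseteq> V"
    using U(1) openin_tau_Q_ball by metis
  have tail: "f n \<in> V" if "k \<le> n" for n
  proof -
    have "int (Q_modulus Q k) dvd f n - a"
      using assms Q_modulus_mono[OF that, of Q] unfolding Q_lim_def by (blast intro: dvd_trans)
    then show ?thesis using k by (auto simp: Q_ball_def)
  qed
  have "\<forall>n. \<exists>W\<in>\<U>. f n \<in> W" using U(2) by blast
  then obtain W where W: "\<And>n. W n \<in> \<U>" "\<And>n. f n \<in> W n" by metis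
  have "f n \<in> \<Union>(insert V (W ` {..<k}))" for n
    using tail[of n] W(2)[of n] by (cases "n < k") auto
  then have "insert a (range f) \<subseteq> \<Union>(insert V (W ` {..<k}))"
    using V(2) by blast
  moreover have "insert V (W ` {..<k}) \<subseteq> \<U>" using V(1) W(1) by blast
  ultimately show "\<exists>\<F>. finite \<F> \<and> \<F> \<subseteq> \<U> \<and> insert a (range f) \<subseteq> \<Union>\<F>"
    by (intro exI[of _ "insert V (W ` {..<k})"]) auto
qed

text \<open>A convergent sequence together with its limit is compact, so it is a bounded family with
  one member, and \<open>h\<close> maps it into a translate of a compact set. This replaces
  continuity of \<open>h\<close>, which need not hold.\<close>

lemma controlled_subconvergent:
  assumes "controlled Q h" "Q_lim Q z y"
  obtains m r where "strict_mono r" "Q_lim Q (h \<circ> z \<circ> r) m"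
proof -
  have "uniformly_bounded Q UNIV (\<lambda>_ :: unit. insert y (range z))"
    unfolding uniformly_bounded_def using Q_lim_compactin[OF assms(2)]
    by (intro exI[of _ "insert y (range z)"] conjI ballI exI[of _ 0]) auto
  then have "uniformly_bounded Q UNIV (\<lambda>_ :: unit. h ` insert y (range z))"
    by (rule controlledD[OF assms(1)])
  then obtain M k where M: "compactin (tau Q) M" "h ` insert y (range z) \<subseteq> (\<lambda>x. k + x) ` M"
    by (auto simp: uniformly_bounded_def)
  have "h (z n) - k \<in> M" for n
  proof -
    have "h (z n) \<in> (\<lambda>x. k + x) ` M" using M(2) by blast
    then show ?thesis by auto
  qed
  then obtain m r where r: "strict_mono r" "Q_lim Q ((\<lambda>n. h (z n) - k) \<circ> r) m"
    using Q_seq_compactE[OF compactin_imp_Q_seq_compact[OF M(1)], of "\<lambda>n. h (z n) - k"] by metis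
  have "Q_lim Q (h \<circ> z \<circ> r) (m + k)"
    using Q_lim_add[OF r(2) Q_lim_const[of Q k]] by (simp add: comp_def)
  with r(1) show thesis by (rule that)
qed

section \<open>Countable compact sets and minimal closed sets\<close>

text \<open>Nested balls in \<open>A\<close> that avoid the integers one after the other would shrink to no point.\<close>

lemma exists_isolated_point:
  assumes "Q \<noteq> {}" "\<forall>p\<in>Q. prime p" "Q_seq_compact Q A" "E \<subseteq> A" "E \<noteq> {}"
  obtains e k where "e \<in> E" "E \<inter> Q_ball Q e k = {e}"
proof (rule ccontr)
  assume "\<not> thesis"
  then have no_iso: "E \<inter> Q_ball Q e k \<noteq> {e}" if "e \<in> E" for e k
    using that \<open>\<And>e k. \<lbrakk>e \<in> E; E \<inter> Q_ball Q e k = {e}\<rbrakk> \<Longrightarrow> thesis\<close> by blast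
  have another: "\<exists>e'\<in>E. e' \<noteq> e \<and> int (Q_modulus Q k) dvd e' - e" if "e \<in> E" for e k
  proof -
    have "e \<in> E \<inter> Q_ball Q e k" using that by (simp add: Q_ball_def)
    then show ?thesis using no_iso[OF that, of k] by (auto simp: Q_ball_def)
  qed
  obtain e0 where e0: "e0 \<in> E" using assms(5) by blast
  \<comment> \<open>A state is a pair of centre and radius index; the ball chosen at stage
    \<open>Suc n\<close> excludes the integer with number \<open>n\<close>.\<close>
  have "\<exists>s. \<forall>n. fst (s n) \<in> E \<and>
      (int (Q_modulus Q (snd (s n))) dvd fst (s (Suc n)) - fst (s n) \<and>
       snd (s n) \<le> snd (s (Suc n)) \<and>
       \<not> int (Q_modulus Q (snd (s (Suc n)))) dvd from_nat n - fst (s (Suc n)))"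
  proof (rule dependent_nat_choice)
    show "\<exists>x :: int \<times> nat. fst x \<in> E"
      using e0 by (intro exI[of _ "(e0, 0)"]) simp
    fix x :: "int \<times> nat" and n assume x: "fst x \<in> E"
    \<comment> \<open>The old centre is kept unless it is the integer to be avoided; then
      non-isolation supplies another point of \<open>E\<close> in the same ball.\<close>
    obtain c where c: "c \<in> E" "c \<noteq> from_nat n" "int (Q_modulus Q (snd x)) dvd c - fst x"
      using another[OF x, of "snd x"] x by (cases "fst x = from_nat n") auto
    obtain k where k: "\<not> int (Q_modulus Q k) dvd from_nat n - c"
      using Q_modulus_separates[OF assms(1,2), of "from_nat n - c"] c(2) by auto
    have "\<not> int (Q_modulus Q (max k (snd x))) dvd from_nat n - c"
      using k dvd_trans[OF Q_modulus_mono[of k "max k (snd x)" Q]] by auto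
    then show "\<exists>y. fst y \<in> E \<and> (int (Q_modulus Q (snd x)) dvd fst y - fst x \<and> snd x \<le> snd y \<and>
       \<not> int (Q_modulus Q (snd y)) dvd from_nat n - fst y)"
      using c by (intro exI[of _ "(c, max k (snd x))"]) auto
  qed
  then obtain s where s: "\<forall>n. fst (s n) \<in> E \<and>
      (int (Q_modulus Q (snd (s n))) dvd fst (s (Suc n)) - fst (s n) \<and>
       snd (s n) \<le> snd (s (Suc n)) \<and>
       \<not> int (Q_modulus Q (snd (s (Suc n)))) dvd from_nat n - fst (s (Suc n)))"
    by blast
  define c where "c n = fst (s n)" for n
  define k where "k n = snd (s n)" for n
  have cE: "c n \<in> E" and next_in_ball: "int (Q_modulus Q (k n)) dvd c (Suc n) - c n"
    and kS: "k n \<le> k (Suc n)" and avoid: "\<not> int (Q_modulus Q (k (Suc n))) dvd from_nat n - c (Suc n)"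
    for n
    using s by (auto simp: c_def k_def)
  have nested: "int (Q_modulus Q (k i)) dvd c j - c i" if "i \<le> j" for i j
    using that
  proof (induction j rule: dec_induct)
    case (step n)
    have "k i \<le> k n" by (rule lift_Suc_mono_le[of k, OF kS step.hyps(1)])
    then have "int (Q_modulus Q (k i)) dvd c (Suc n) - c n"
      using next_in_ball[of n] by (rule dvd_trans[OF Q_modulus_mono])
    from dvd_add[OF this step.IH] show ?case by simp
  qed simp
  obtain d r where r: "strict_mono r" "Q_lim Q (c \<circ> r) d"
    by (rule Q_seq_compactE[OF assms(3), of c]) (use cE assms(4) in blast)+
  \<comment> \<open>Countability enters here: the limit \<open>d\<close> has a number
    \<open>n\<close>, so it was excluded at stage \<open>Suc n\<close>, although it lies in every
    ball of the nest.\<close>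
  obtain n where n: "from_nat n = d"
    by (metis from_nat_to_nat)
  define j where "j = max (Suc n) (k (Suc n))"
  have "Suc n \<le> r j" "k (Suc n) \<le> j"
    using seq_suble[OF r(1), of j] by (auto simp: j_def)
  have "int (Q_modulus Q j) dvd c (r j) - d"
    using r(2) by (simp add: Q_lim_def)
  with Q_modulus_mono[OF \<open>k (Suc n) \<le> j\<close>] have "int (Q_modulus Q (k (Suc n))) dvd c (r j) - d"
    by (rule dvd_trans)
  with nested[OF \<open>Suc n \<le> r j\<close>]
  have "int (Q_modulus Q (k (Suc n))) dvd (c (r j) - c (Suc n)) - (c (r j) - d)"
    by (rule dvd_diff)
  then show False using avoid[of n] n by simp
qed

text \<open>There are only countably many balls, so a greedy deletion replaces Zorn's lemma: each
  ball is removed at its turn if \<open>R\<close> survives. A ball that can be removed from the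
  final intersection could, by monotonicity, have been removed at its turn, so it is already
  disjoint from the intersection.\<close>

lemma minimal_Q_closed:
  assumes "Q_closed Q A" "R A"
    and mono: "\<And>X Y. R X \<Longrightarrow> X \<subseteq> Y \<Longrightarrow> R Y"
    and inter: "\<And>X. (\<And>n. Q_closed Q (X n)) \<Longrightarrow> (\<And>n. R (X n)) \<Longrightarrow> decseq X \<Longrightarrow> R (\<Inter>n. X n)"
  obtains E where "Q_closed Q E" "E \<subseteq> A" "R E" "\<And>e k. R (E - Q_ball Q e k) \<Longrightarrow> e \<notin> E"
proof -
  define B where "B n = (case from_nat n of (a, k) \<Rightarrow> Q_ball Q a k)" for n
  define X where "X = rec_nat A (\<lambda>n Y. if R (Y - B n) then Y - B n else Y)"
  have X0: "X 0 = A" and XS: "X (Suc n) = (if R (X n - B n) then X n - B n else X n)" for n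
    by (auto simp: X_def)
  have closed: "Q_closed Q (X n)" for n
    by (induction n) (auto simp: X0 XS assms(1) B_def Q_closed_diff_ball split: prod.split)
  have RX: "R (X n)" for n
    by (induction n) (auto simp: X0 XS assms(2))
  have dec: "decseq X"
    by (rule decseq_SucI) (simp add: XS)
  show thesis
  proof (rule that[of "\<Inter>n. X n"])
    show "Q_closed Q (\<Inter>n. X n)" using closed by (rule Q_closed_Inter)
    show "(\<Inter>n. X n) \<subseteq> A" using X0 by blast
    show "R (\<Inter>n. X n)" using closed RX dec by (rule inter)
    fix e k assume R: "R ((\<Inter>n. X n) - Q_ball Q e k)"
    obtain n where n: "B n = Q_ball Q e k"
      unfolding B_def by (metis case_prod_conv from_nat_to_nat)
    have "R (X n - B n)"
      by (rule mono[OF R]) (auto simp: n)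
    then have "X (Suc n) = X n - Q_ball Q e k" by (simp add: XS n)
    then have "e \<notin> X (Suc n)" by (simp add: Q_ball_def)
    then show "e \<notin> (\<Inter>n. X n)" by blast
  qed
qed

section \<open>Primes outside \<open>Q\<close>\<close>

definition graph_closure :: "nat set \<Rightarrow> (int \<Rightarrow> int) \<Rightarrow> (int \<times> int) set" where
  "graph_closure Q h = {(y, m). \<exists>z. Q_lim Q z y \<and> Q_lim Q (h \<circ> z) m}"

text \<open>Diagonal argument: replace the \<open>n\<close>-th point by a point of the graph that
  agrees with it modulo \<open>Q_modulus Q n\<close>, then use subconvergence for \<open>h\<close>
  itself.\<close>

lemma graph_closure_subconvergent:
  assumes "controlled Q h" "Q_lim Q z y" "\<And>n. (z n, m n) \<in> graph_closure Q h"
  obtains l r where "strict_mono r" "Q_lim Q (m \<circ> r) l" "(y, l) \<in> graph_closure Q h"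
proof -
  have "\<exists>x. int (Q_modulus Q n) dvd x - z n \<and> int (Q_modulus Q n) dvd h x - m n" for n
    using assms(3)[of n] by (auto simp: graph_closure_def Q_lim_def)
  then obtain x where x: "\<And>n. int (Q_modulus Q n) dvd x n - z n"
      "\<And>n. int (Q_modulus Q n) dvd h (x n) - m n"
    by metis
  have "Q_lim Q (\<lambda>n. x n - z n) 0" "Q_lim Q (\<lambda>n. h (x n) - m n) 0"
    using x by (auto simp: Q_lim_def)
  then have xy: "Q_lim Q x y" and hm: "Q_lim Q (\<lambda>n. h (x n) - m n) 0"
    using Q_lim_add[OF _ assms(2), of "\<lambda>n. x n - z n" 0] by auto
  obtain l r where r: "strict_mono r" "Q_lim Q (h \<circ> x \<circ> r) l"
    using controlled_subconvergent[OF assms(1) xy] by blast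
  have "Q_lim Q (m \<circ> r) l"
    using Q_lim_diff[OF r(2) Q_lim_subseq[OF hm r(1)]] by (simp add: comp_def)
  moreover have "(y, l) \<in> graph_closure Q h"
    using Q_lim_subseq[OF xy r(1)] r(2) by (auto simp: graph_closure_def comp_assoc)
  ultimately show thesis using that r(1) by blast
qed

lemma close_mult_comp_imp_in:
  fixes p :: nat
  assumes "Q \<noteq> {}" "Q \<subseteq> {p. prime p}" "prime p"
    and "controlled Q h" "close Q ((\<lambda>k. int p * k) \<circ> h) id"
  shows "p \<in> Q"
proof (rule ccontr)
  assume "p \<notin> Q"
  have Q: "\<forall>p\<in>Q. prime p" using assms(2) by blast
  define G where "G = graph_closure Q h"
  obtain K where K: "compactin (tau Q) K" "\<And>x. \<exists>k. {int p * h x, x} \<subseteq> (\<lambda>x. k + x) ` K"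
    using assms(5) by (auto simp: close_def uniformly_bounded_def)
  \<comment> \<open>Both \<open>int p * h x\<close> and \<open>x\<close> lie in one translate of
    \<open>K\<close>; taking the difference removes the unknown translation.\<close>
  define A where "A = {a - b |a b. a \<in> K \<and> b \<in> K}"
  have A: "Q_seq_compact Q A"
    unfolding A_def using K(1) by (intro Q_seq_compact_differences compactin_imp_Q_seq_compact)
  have hA: "int p * h x - x \<in> A" for x
  proof -
    obtain k where "{int p * h x, x} \<subseteq> (\<lambda>x. k + x) ` K" using K(2) by blast
    then obtain a b where "a \<in> K" "b \<in> K" "int p * h x = k + a" "x = k + b" by blast
    moreover from this have "int p * h x - x = a - b" by linarith
    ultimately show ?thesis unfolding A_def by blast
  qed
  \<comment> \<open>\<open>R E\<close> says that over every \<open>y\<close> the closure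
    \<open>G\<close> contains an approximate quotient of \<open>y\<close> by \<open>p\<close> with
    error in \<open>E\<close>.\<close>
  define R where "R E \<longleftrightarrow> (\<forall>y. \<exists>m. (y, m) \<in> G \<and> int p * m - y \<in> E)" for E
  have limit: "\<exists>m r. strict_mono r \<and> (y, m) \<in> G \<and>
      Q_lim Q (\<lambda>n. int p * f (r n) - z (r n)) (int p * m - y)"
    if zy: "Q_lim Q z y" and f: "\<And>n. (z n, f n) \<in> G" for z y f
  proof -
    obtain m r where m: "strict_mono r" "Q_lim Q (f \<circ> r) m" "(y, m) \<in> G"
      using graph_closure_subconvergent[OF assms(4) zy, of f] f unfolding G_def by blast
    moreover have "Q_lim Q (\<lambda>n. int p * f (r n) - z (r n)) (int p * m - y)"
      using Q_lim_diff[OF Q_lim_mult[OF m(2)] Q_lim_subseq[OF zy m(1)]] by (simp add: comp_def)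
    ultimately show ?thesis by blast
  qed
  obtain E where E: "Q_closed Q E" "E \<subseteq> A" "R E" "\<And>e k. R (E - Q_ball Q e k) \<Longrightarrow> e \<notin> E"
  proof (rule minimal_Q_closed[of Q A R])
    show "Q_closed Q A" using assms(1) Q A by (rule Q_seq_compact_imp_closed)
    have "(y, h y) \<in> G" for y
      unfolding G_def graph_closure_def by (auto simp: comp_def intro!: exI[of _ "\<lambda>_. y"] Q_lim_const)
    then show "R A" using hA unfolding R_def by blast
    show "R Y" if "R X" "X \<subseteq> Y" for X Y using that unfolding R_def by blast
    show "R (\<Inter>n. X n)" if X: "\<And>n. Q_closed Q (X n)" "\<And>n. R (X n)" "decseq X" for X
      unfolding R_def
    proof
      fix y
      have "\<forall>n. \<exists>m. (y, m) \<in> G \<and> int p * m - y \<in> X n" using X(2) unfolding R_def by blast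
      from choice[OF this] obtain f where f: "\<And>n. (y, f n) \<in> G" "\<And>n. int p * f n - y \<in> X n"
        by blast
      obtain m r where m: "strict_mono r" "(y, m) \<in> G"
          "Q_lim Q (\<lambda>n. int p * f (r n) - y) (int p * m - y)"
        using limit[OF Q_lim_const[of Q y], of f] f(1) by auto
      have "int p * m - y \<in> X i" for i
      proof (rule Q_closedD[OF X(1)])
        \<comment> \<open>The shift by \<open>i\<close> drops the terms that may lie outside
          \<open>X i\<close>; the later ones lie in it as \<open>X\<close> decreases.\<close>
        show "Q_lim Q ((\<lambda>n. int p * f (r n) - y) \<circ> (\<lambda>n. n + i)) (int p * m - y)"
          by (rule Q_lim_subseq[OF m(3)]) (simp add: strict_mono_def)
        show "((\<lambda>n. int p * f (r n) - y) \<circ> (\<lambda>n. n + i)) n \<in> X i" for n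
        proof -
          have "i \<le> r (n + i)" using seq_suble[OF m(1), of "n + i"] by linarith
          then show ?thesis using f(2)[of "r (n + i)"] decseqD[OF X(3), of i "r (n + i)"] by auto
        qed
      qed
      with m(2) show "\<exists>m. (y, m) \<in> G \<and> int p * m - y \<in> (\<Inter>n. X n)" by blast
    qed
  qed blast
  have "E \<noteq> {}" using E(3) unfolding R_def by blast
  then obtain e k where e: "e \<in> E" "E \<inter> Q_ball Q e k = {e}"
    using exists_isolated_point[OF assms(1) Q A E(2)] by blast
  have "R (E - Q_ball Q e k)"
    unfolding R_def
  proof
    fix y
    \<comment> \<open>The perturbation tends to 0 in \<open>\<tau>\<^sub>Q\<close>, yet it is never
      divisible by \<open>p\<close>, being in \<open>Q_numbers Q\<close> with
      \<open>p \<notin> Q\<close>.\<close>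
    define z where "z n = y + int (Q_modulus Q n)" for n
    have zy: "Q_lim Q z y" by (simp add: Q_lim_def z_def)
    have "\<forall>n. \<exists>m. (z n, m) \<in> G \<and> int p * m - z n \<in> E" using E(3) unfolding R_def by blast
    from choice[OF this] obtain f where f: "\<And>n. (z n, f n) \<in> G" "\<And>n. int p * f n - z n \<in> E"
      by blast
    obtain m r where m: "strict_mono r" "(y, m) \<in> G"
        "Q_lim Q (\<lambda>n. int p * f (r n) - z (r n)) (int p * m - y)"
      using limit[OF zy, of f] f(1) by auto
    have mE: "int p * m - y \<in> E"
      using Q_closedD[OF E(1) _ m(3)] f(2) by blast
    moreover have "int p * m - y \<notin> Q_ball Q e k"
    proof
      assume "int p * m - y \<in> Q_ball Q e k"
      then have me: "int p * m - y = e" using mE e(2) by blast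
      \<comment> \<open>At index \<open>k\<close> the prescribed rate already puts the approximant
        into the ball of index \<open>k\<close> around \<open>e\<close>; isolation then forces
        equality with the limit.\<close>
      then have "int p * f (r k) - z (r k) \<in> Q_ball Q e k"
        using m(3) by (auto simp: Q_lim_def Q_ball_def)
      then have "int p * f (r k) - z (r k) = e" using e(2) f(2) by blast
      then have "int (Q_modulus Q (r k)) = int p * (f (r k) - m)"
        using me by (simp add: z_def algebra_simps)
      then have "int p dvd int (Q_modulus Q (r k))" by simp
      then have "p dvd Q_modulus Q (r k)" by (simp only: int_dvd_int_iff)
      moreover have "coprime (Q_modulus Q (r k)) p"
        using Q_modulus_in[of Q "r k"] \<open>p \<notin> Q\<close> assms(3) by (simp add: Q_numbers_def)
      ultimately show False
        using assms(3) by (metis coprime_commute coprime_absorb_left not_prime_unit)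
    qed
    ultimately show "\<exists>m. (y, m) \<in> G \<and> int p * m - y \<in> E - Q_ball Q e k" using m(2) by blast
  qed
  then show False using E(4) e(1) by blast
qed

section \<open>Primes in \<open>Q\<close>\<close>

lemma continuous_map_tauI:
  assumes "\<And>k m. m \<in> Q_numbers Q \<Longrightarrow>
    \<exists>n\<in>Q_numbers Q. \<forall>j. int m dvd f (k + int n * j) - f k"
  shows "continuous_map (tau Q) (tau Q) f"
  unfolding continuous_map_def
proof (intro conjI allI impI)
  fix U assume U: "openin (tau Q) U"
  show "openin (tau Q) {x \<in> topspace (tau Q). f x \<in> U}"
    unfolding openin_tau_iff
  proof
    fix k assume "k \<in> {x \<in> topspace (tau Q). f x \<in> U}"
    then obtain m where m: "m \<in> Q_numbers Q" "range (\<lambda>j. f k + int m * j) \<subseteq> U"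
      using U openin_tau_iff by auto
    obtain n where n: "n \<in> Q_numbers Q" "\<And>j. int m dvd f (k + int n * j) - f k"
      using assms[OF m(1), of k] by blast
    have "f (k + int n * j) \<in> U" for j
    proof -
      obtain i where "f (k + int n * j) - f k = int m * i" using n(2)[of j] by (elim dvdE)
      then have "f (k + int n * j) = f k + int m * i" by simp
      then show ?thesis using m(2) by auto
    qed
    then show "\<exists>m\<in>Q_numbers Q. range (\<lambda>j. k + int m * j) \<subseteq> {x \<in> topspace (tau Q). f x \<in> U}"
      using n(1) by auto
  qed
qed auto

text \<open>Up to an additive constant, \<open>f\<close> on a translate of \<open>K\<close> agrees
  with \<open>f\<close> on one of the translates by elements of \<open>S\<close>. The images of
  these finitely many translates are compact by continuity, and so is their union.\<close>

lemma continuous_imp_controlled: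
  assumes cont: "continuous_map (tau Q) (tau Q) f" and "finite S"
    and transl: "\<And>k. \<exists>s\<in>S. \<exists>c. \<forall>x. f (k + x) = c + f (s + x)"
  shows "controlled Q f"
  unfolding controlled_def
proof (intro allI impI)
  fix I :: "int set set" and A assume "uniformly_bounded Q I A"
  then obtain K where K: "compactin (tau Q) K" "\<And>i. i \<in> I \<Longrightarrow> \<exists>k. A i \<subseteq> (\<lambda>x. k + x) ` K"
    by (auto simp: uniformly_bounded_def)
  define M where "M = (\<Union>s\<in>S. (\<lambda>x. f (s + x)) ` K)"
  have "compactin (tau Q) ((\<lambda>x. f (s + x)) ` K)" for s
  proof -
    have "continuous_map (tau Q) (tau Q) ((+) s)"
    proof (rule continuous_map_tauI)
      fix k m assume "m \<in> Q_numbers Q"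
      then show "\<exists>n\<in>Q_numbers Q. \<forall>j. int m dvd s + (k + int n * j) - (s + k)"
        by (intro bexI[of _ m]) auto
    qed
    then have "continuous_map (tau Q) (tau Q) (f \<circ> (+) s)"
      using cont by (rule continuous_map_compose)
    then show ?thesis
      using image_compactin[OF K(1)] by (simp add: comp_def)
  qed
  then have "compactin (tau Q) M"
    unfolding M_def using assms(2) by (intro compactin_Union) auto
  moreover have "\<exists>k. f ` A i \<subseteq> (\<lambda>x. k + x) ` M" if i: "i \<in> I" for i
  proof -
    obtain k where k: "A i \<subseteq> (\<lambda>x. k + x) ` K" using K(2)[OF i] by blast
    obtain s c where s: "s \<in> S" "\<And>x. f (k + x) = c + f (s + x)" using transl by blast
    have "f ` A i \<subseteq> (\<lambda>x. c + x) ` M"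
    proof
      fix y assume "y \<in> f ` A i"
      then obtain x where "x \<in> K" "y = f (k + x)" using k by blast
      moreover from this have "f (s + x) \<in> M" using s(1) unfolding M_def by blast
      ultimately show "y \<in> (\<lambda>x. c + x) ` M" using s(2) by blast
    qed
    then show ?thesis by blast
  qed
  ultimately show "uniformly_bounded Q I (\<lambda>i. f ` A i)"
    unfolding uniformly_bounded_def by blast
qed

section \<open>Multiplication and its coarse inverse\<close>

lemma controlled_mult: "controlled Q (\<lambda>k. c * k)"
proof (rule continuous_imp_controlled[of _ _ "{0}"])
  show "continuous_map (tau Q) (tau Q) (\<lambda>k. c * k)"
  proof (rule continuous_map_tauI)
    fix k m assume "m \<in> Q_numbers Q"
    then show "\<exists>n\<in>Q_numbers Q. \<forall>j. int m dvd c * (k + int n * j) - c * k"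
      by (intro bexI[of _ m]) (auto simp: algebra_simps)
  qed
qed (auto simp: algebra_simps)

text \<open>Translating by a multiple of \<open>d\<close> shifts the quotient by a constant, so the
  residues modulo \<open>d\<close> represent all translations. For continuity, the quotient modulo
  \<open>m\<close> is determined by the argument modulo \<open>d * m\<close>, which is again in
  \<open>Q_numbers Q\<close>.\<close>

lemma controlled_div:
  assumes "d \<in> Q_numbers Q"
  shows "controlled Q (\<lambda>k. k div int d)"
proof (rule continuous_imp_controlled[of _ _ "{0..<int d}"])
  have d: "d > 0" using assms by (simp add: Q_numbers_def)
  show "continuous_map (tau Q) (tau Q) (\<lambda>k. k div int d)"
  proof (rule continuous_map_tauI)
    fix k m assume m: "m \<in> Q_numbers Q"
    have "(k + int (d * m) * j) div int d - k div int d = int m * j" for j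
      using d by (simp add: mult.assoc)
    moreover have "d * m \<in> Q_numbers Q"
      using assms m by (auto simp: Q_numbers_def)
    ultimately show "\<exists>n\<in>Q_numbers Q. \<forall>j. int m dvd (k + int n * j) div int d - k div int d"
      by (intro bexI[of _ "d * m"]) auto
  qed
  show "\<exists>s\<in>{0..<int d}. \<exists>c. \<forall>x. (k + x) div int d = c + (s + x) div int d" for k
  proof (intro bexI exI allI)
    fix x
    have "k + x = (k mod int d + x) + int d * (k div int d)"
      by (simp add: algebra_simps)
    then have "(k + x) div int d = ((k mod int d + x) + int d * (k div int d)) div int d"
      by presburger
    also have "\<dots> = k div int d + (k mod int d + x) div int d"
      using d by (intro div_mult_self2) simp
    finally show "(k + x) div int d = k div int d + (k mod int d + x) div int d" .
  qed (use d in auto)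
qed simp

lemma coarse_equivalence_mult:
  assumes "d \<in> Q_numbers Q"
  shows "coarse_equivalence Q (\<lambda>k. int d * k)"
proof -
  have d: "d > 0" using assms by (simp add: Q_numbers_def)
  \<comment> \<open>This composite is exactly the identity, so a single point bounds the
    family.\<close>
  have "close Q ((\<lambda>k. k div int d) \<circ> (\<lambda>k. int d * k)) id"
    unfolding close_def uniformly_bounded_def using d
    by (intro exI[of _ "{0}"] conjI ballI finite_imp_compactin) auto
  moreover have "close Q ((\<lambda>k. int d * k) \<circ> (\<lambda>k. k div int d)) id"
    unfolding close_def uniformly_bounded_def
  \<comment> \<open>The other composite subtracts the remainder; the finite interval contains its
    negative and also 0, for the point \<open>x\<close> itself.\<close>
  proof (intro exI[of _ "{- int d..0}"] conjI ballI finite_imp_compactin)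
    fix x
    have "int d * (x div int d) = x - x mod int d" by (simp add: minus_mod_eq_mult_div)
    moreover have "- (x mod int d) \<in> {- int d..0}"
      using pos_mod_bound[of "int d" x] pos_mod_sign[of "int d" x] d unfolding atLeastAtMost_iff by linarith
    then have "x - x mod int d \<in> (\<lambda>y. x + y) ` {- int d..0}"
      by (intro image_eqI[of _ _ "- (x mod int d)"]) simp
    moreover have "x \<in> (\<lambda>y. x + y) ` {- int d..0}"
      by (intro image_eqI[of _ _ 0]) auto
    ultimately show "\<exists>k. {((\<lambda>k. int d * k) \<circ> (\<lambda>k. k div int d)) x, id x}
        \<subseteq> (\<lambda>y. k + y) ` {- int d..0}"
      by (intro exI[of _ x]) auto
  qed auto
  ultimately show ?thesis
    unfolding coarse_equivalence_def using controlled_mult controlled_div[OF assms] by blast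
qed

theorem theorem4p4:
  fixes Q :: "nat set"
  assumes "Q \<noteq> {}" and "Q \<subseteq> {p. prime p}"
  shows "prime_power_invertibility_spectrum Q = Q"
proof
  show "prime_power_invertibility_spectrum Q \<subseteq> Q"
    using close_mult_comp_imp_in[OF assms]
    by (auto simp: prime_power_invertibility_spectrum_def coarse_equivalence_def)
  have "p \<in> Q_numbers Q" if "p \<in> Q" for p
    using that assms(2) by (auto simp: Q_numbers_def prime_gt_0_nat intro!: primes_coprime)
  then show "Q \<subseteq> prime_power_invertibility_spectrum Q"
    using assms(2) coarse_equivalence_mult by (auto simp: prime_power_invertibility_spectrum_def)
qed

end
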